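(* Let $b\ge 1$, let $M$ be an upper (respectively lower) triangular $b\times b$ real matrix, and let $k_1,k_2\ge 0$ be integers with $0<k_1+k_2<b$. Then: 1. $\mathrm{tr}_{k_1,k_2}M$ is also an upper (respectively lower) triangular matrix. 2. If $N$ is also an upper (respectively lower) triangular $b\times b$ matrix, then $\mathrm{tr}_{k_1,k_2}(MN)=(\mathrm{tr}_{k_1,k_2}M)(\mathrm{tr}_{k_1,k_2}N)$. 3. If $M$ is invertible, then $\mathrm{tr}_{k_1,k_2}(M^{-1})=(\mathrm{tr}_{k_1,k_2}M)^{-1}$.
   Context: For a $b\times b$ matrix $M$, $\mathrm{tr}_{k_1,k_2}M$ denotes the truncated $(b-k_1-k_2)\times(b-k_1-k_2)$ matrix obtained from $M$ by deleting its first $k_1$ rows and columns and its last $k_2$ rows and columns (it is not a trace). *)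

theory Defs
  imports
    Jordan_Normal_Form.Matrix
    Jordan_Normal_Form.DL_Submatrix
    Jordan_Normal_Form.Gauss_Jordan_Elimination
begin

(* Indices start at 0, so the rows and columns that are kept are k1, ..., b - k2 - 1.
   submatrix renumbers them from 0. *)
definition trunc_mat :: "nat \<Rightarrow> nat \<Rightarrow> 'a mat \<Rightarrow> 'a mat" where
  "trunc_mat k1 k2 M =
    submatrix M {k1..<dim_row M - k2} {k1..<dim_col M - k2}"

definition lower_triangular :: "'a::zero mat \<Rightarrow> bool" where
  "lower_triangular A \<longleftrightarrow>
    (\<forall>i < dim_row A. \<forall>j < dim_col A. i < j \<longrightarrow> A $$ (i, j) = 0)"

(* Total version of mat_inverse; it is unspecified when A is not invertible. *)
definition mat_inv :: "'a::field mat \<Rightarrow> 'a mat" where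
  "mat_inv A = the (mat_inverse A)"

lemma mat_inv:
  assumes A: "A \<in> carrier_mat n n" and inv: "invertible_mat A"
  shows "mat_inv A \<in> carrier_mat n n"
    and "A * mat_inv A = 1\<^sub>m n"
    and "mat_inv A * A = 1\<^sub>m n"
proof -
  from inv obtain B where AB: "A * B = 1\<^sub>m n" and BA: "B * A = 1\<^sub>m (dim_row B)"
    using A by (auto simp: invertible_mat_def inverts_mat_def)
  have "dim_col B = n"
    using arg_cong[OF AB, of dim_col] by simp
  moreover have "dim_row B = n"
    using arg_cong[OF BA, of dim_col] A by simp
  ultimately have "A \<in> Units (ring_mat TYPE('a) n ())"
    using A AB BA by (auto simp: Units_def ring_mat_def intro!: bexI[of _ B])
  then obtain C where "mat_inverse A = Some C"
    using mat_inverse(1)[OF A, of "()"] by (cases "mat_inverse A") auto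
  then show "mat_inv A \<in> carrier_mat n n" "A * mat_inv A = 1\<^sub>m n" "mat_inv A * A = 1\<^sub>m n"
    using mat_inverse(2)[OF A] by (auto simp: mat_inv_def)
qed

end

theory Submission
  imports Defs
begin

text \<open>
  Truncation keeps the entries whose row and column both lie in the window
  \<open>W = {k1, ..., b - k2 - 1}\<close>. It respects the order of the indices, so it preserves triangularity.

  For general matrices it does not respect products: for \<open>i, j \<in> W\<close> the \<open>(i, j)\<close> entry of \<open>A * B\<close>
  also contains the terms \<open>A\<^sub>i\<^sub>l B\<^sub>l\<^sub>j\<close> with \<open>l \<notin> W\<close>. Since \<open>W\<close> is an interval, such an \<open>l\<close> lies below
  both \<open>i\<close> and \<open>j\<close> or above both. If \<open>A\<close> and \<open>B\<close> are triangular of the same kind, then in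
  either case one of the two factors is on the vanishing side of the diagonal, and the extra terms
  disappear (\<open>trunc_mat_mult\<close>, \<open>trunc_mat_mult_triangular\<close>).

  For the inverse, the product rule is applied to \<open>M * M\<^sup>-\<^sup>1 = 1 = M\<^sup>-\<^sup>1 * M\<close>; this requires that \<open>M\<^sup>-\<^sup>1\<close>
  is triangular of the same kind as \<open>M\<close> (\<open>left_inverse_upper_triangular\<close>, and its transpose).
  The truncation of the identity is the identity, so the truncation of \<open>M\<^sup>-\<^sup>1\<close> is a two-sided inverse
  of the truncation of \<open>M\<close>, and inverses are unique.
\<close>

lemma pick_atLeastLessThan:
  assumes "i < n - m"
  shows "pick {m..<n} i = m + i"
  using assms
proof (induction i)
  case 0
  then show ?case by (auto intro!: Least_equality)
next
  case (Suc i)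
  then show ?case by (auto intro!: Least_equality)
qed

lemma trunc_mat_carrier:
  assumes "A \<in> carrier_mat m n"
  shows "trunc_mat k1 k2 A \<in> carrier_mat (m - k1 - k2) (n - k1 - k2)"
proof -
  have "{i. i < p \<and> i \<in> {k1..<p - k2}} = {k1..<p - k2}" for p by auto
  then show ?thesis
    using assms by (auto simp: trunc_mat_def dim_submatrix)
qed

lemma trunc_mat_index:
  assumes "A \<in> carrier_mat m n" "i < m - k1 - k2" "j < n - k1 - k2"
  shows "trunc_mat k1 k2 A $$ (i, j) = A $$ (k1 + i, k1 + j)"
proof -
  have "{i. i < p \<and> i \<in> {k1..<p - k2}} = {k1..<p - k2}" for p by auto
  then show ?thesis
    using assms by (auto simp: trunc_mat_def submatrix_index pick_atLeastLessThan)
qed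

lemma trunc_mat_one: "trunc_mat k1 k2 (1\<^sub>m b) = 1\<^sub>m (b - k1 - k2)"
  using trunc_mat_carrier[OF one_carrier_mat[of b], of k1 k2]
  by (intro eq_matI) (auto simp: trunc_mat_index[OF one_carrier_mat])

lemma upper_triangular_trunc_mat:
  assumes "A \<in> carrier_mat b b" "upper_triangular A"
  shows "upper_triangular (trunc_mat k1 k2 A)"
  using assms trunc_mat_carrier[OF assms(1), of k1 k2]
  by (auto simp: upper_triangular_def trunc_mat_index)

lemma lower_triangular_trunc_mat:
  assumes "A \<in> carrier_mat b b" "lower_triangular A"
  shows "lower_triangular (trunc_mat k1 k2 A)"
  using assms trunc_mat_carrier[OF assms(1), of k1 k2]
  by (auto simp: lower_triangular_def trunc_mat_index)

text \<open>The only obstruction to multiplicativity is the part of the inner sum outside the window.\<close>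

lemma trunc_mat_mult:
  fixes A B :: "'a::semiring_0 mat"
  assumes A: "A \<in> carrier_mat b b" and B: "B \<in> carrier_mat b b"
    and outside: "\<And>i j l. \<lbrakk>i \<in> {k1..<b - k2}; j \<in> {k1..<b - k2}; l < b; l \<notin> {k1..<b - k2}\<rbrakk>
      \<Longrightarrow> A $$ (i, l) * B $$ (l, j) = 0"
  shows "trunc_mat k1 k2 (A * B) = trunc_mat k1 k2 A * trunc_mat k1 k2 B"
proof (rule eq_matI)
  let ?d = "b - k1 - k2"
  note carrier = trunc_mat_carrier[OF A, of k1 k2] trunc_mat_carrier[OF B, of k1 k2]
  have AB: "A * B \<in> carrier_mat b b" using A B by simp
  note carrier_AB = trunc_mat_carrier[OF AB, of k1 k2]
  show "dim_row (trunc_mat k1 k2 (A * B)) = dim_row (trunc_mat k1 k2 A * trunc_mat k1 k2 B)"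
    "dim_col (trunc_mat k1 k2 (A * B)) = dim_col (trunc_mat k1 k2 A * trunc_mat k1 k2 B)"
    using carrier carrier_AB by auto
  fix i j
  assume "i < dim_row (trunc_mat k1 k2 A * trunc_mat k1 k2 B)"
    "j < dim_col (trunc_mat k1 k2 A * trunc_mat k1 k2 B)"
  then have ij: "i < ?d" "j < ?d" using carrier by auto
  have "trunc_mat k1 k2 (A * B) $$ (i, j)
      = (\<Sum>l = 0..<b. A $$ (k1 + i, l) * B $$ (l, k1 + j))"
    using ij A B by (simp add: trunc_mat_index[OF AB] scalar_prod_def)
  also have "\<dots> = (\<Sum>l = k1..<b - k2. A $$ (k1 + i, l) * B $$ (l, k1 + j))"
    using ij by (intro sum.mono_neutral_right) (auto intro!: outside)
  also have "\<dots> = (\<Sum>l = 0..<?d. A $$ (k1 + i, k1 + l) * B $$ (k1 + l, k1 + j))"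
    using ij by (intro sum.reindex_bij_witness[of _ "\<lambda>l. k1 + l" "\<lambda>l. l - k1"]) auto
  also have "\<dots> = (trunc_mat k1 k2 A * trunc_mat k1 k2 B) $$ (i, j)"
    using ij carrier
    by (simp add: scalar_prod_def trunc_mat_index[OF A] trunc_mat_index[OF B])
  finally show "trunc_mat k1 k2 (A * B) $$ (i, j)
      = (trunc_mat k1 k2 A * trunc_mat k1 k2 B) $$ (i, j)" .
qed

lemma trunc_mat_mult_triangular:
  fixes A B :: "'a::semiring_0 mat"
  assumes A: "A \<in> carrier_mat b b" and B: "B \<in> carrier_mat b b"
    and "upper_triangular A \<and> upper_triangular B \<or> lower_triangular A \<and> lower_triangular B"
  shows "trunc_mat k1 k2 (A * B) = trunc_mat k1 k2 A * trunc_mat k1 k2 B"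
proof (rule trunc_mat_mult[OF A B])
  fix i j l
  assume "i \<in> {k1..<b - k2}" "j \<in> {k1..<b - k2}" "l < b" "l \<notin> {k1..<b - k2}"
  then have "l < i \<and> l < j \<and> i < b \<and> j < b \<or> i < l \<and> j < l \<and> i < b \<and> j < b" by auto
  then have "A $$ (i, l) = 0 \<or> B $$ (l, j) = 0"
    using assms \<open>l < b\<close> by (auto simp: upper_triangular_def lower_triangular_def)
  then show "A $$ (i, l) * B $$ (l, j) = 0" by auto
qed

text \<open>
  The columns of \<open>B\<close> are treated from left to right. Once the columns before \<open>j\<close> are known to vanish
  below the diagonal, the \<open>(i, j)\<close> entry of \<open>B * A = 1\<close> reduces, for \<open>i \<ge> j\<close>, to the single term
  \<open>B\<^sub>i\<^sub>j A\<^sub>j\<^sub>j\<close>. The case \<open>i = j\<close> shows that \<open>A\<^sub>j\<^sub>j \<noteq> 0\<close>, and then the cases \<open>i > j\<close> show that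
  column \<open>j\<close> vanishes below the diagonal.
\<close>

lemma left_inverse_upper_triangular:
  fixes A B :: "'a::idom mat"
  assumes A: "A \<in> carrier_mat b b" and B: "B \<in> carrier_mat b b"
    and BA: "B * A = 1\<^sub>m b" and upper: "upper_triangular A"
  shows "upper_triangular B"
proof -
  have "\<forall>i < b. j < i \<longrightarrow> B $$ (i, j) = 0" for j
  proof (induction j rule: less_induct)
    case (less j)
    have single: "B $$ (i, j) * A $$ (j, j) = (if i = j then 1 else 0)" if "j \<le> i" "i < b" for i
    proof -
      have "(if i = j then 1 else 0) = (B * A) $$ (i, j)"
        using that by (simp add: BA)
      also have "\<dots> = (\<Sum>l = 0..<b. B $$ (i, l) * A $$ (l, j))"
        using that A B by (simp add: scalar_prod_def)
      also have "\<dots> = (\<Sum>l \<in> {j}. B $$ (i, l) * A $$ (l, j))"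
      proof (rule sum.mono_neutral_right)
        show "\<forall>l \<in> {0..<b} - {j}. B $$ (i, l) * A $$ (l, j) = 0"
        proof
          fix l assume "l \<in> {0..<b} - {j}"
          then consider "l < j" | "j < l" "l < b" by fastforce
          then show "B $$ (i, l) * A $$ (l, j) = 0"
          proof cases
            case 1
            then show ?thesis using less.IH that by auto
          next
            case 2
            then show ?thesis using upper A by (auto simp: upper_triangular_def)
          qed
        qed
      qed (use that in auto)
      finally show ?thesis by simp
    qed
    show ?case
    proof (intro allI impI)
      fix i assume i: "i < b" "j < i"
      have "A $$ (j, j) \<noteq> 0" using single[of j] i by auto
      then show "B $$ (i, j) = 0" using single[of i] i by auto
    qed
  qed
  then show ?thesis using B by (auto simp: upper_triangular_def)
qed

lemma upper_triangular_transpose: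
  assumes "A \<in> carrier_mat n n"
  shows "upper_triangular (transpose_mat A) \<longleftrightarrow> lower_triangular A"
  using assms by (fastforce simp: upper_triangular_def lower_triangular_def)

lemma right_inverse_lower_triangular:
  fixes A B :: "'a::idom mat"
  assumes A: "A \<in> carrier_mat b b" and B: "B \<in> carrier_mat b b"
    and AB: "A * B = 1\<^sub>m b" and lower: "lower_triangular A"
  shows "lower_triangular B"
proof -
  have "transpose_mat B * transpose_mat A = 1\<^sub>m b"
    using transpose_mult[OF A B] AB by simp
  then have "upper_triangular (transpose_mat B)"
    using left_inverse_upper_triangular[of "transpose_mat A" b "transpose_mat B"] A B lower
    by (simp add: upper_triangular_transpose[OF A])
  then show ?thesis by (simp add: upper_triangular_transpose[OF B])
qed

lemma inverse_imp_mat_inv: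
  fixes A B :: "'a::field mat"
  assumes A: "A \<in> carrier_mat n n" and B: "B \<in> carrier_mat n n"
    and AB: "A * B = 1\<^sub>m n" and BA: "B * A = 1\<^sub>m n"
  shows "invertible_mat A" "B = mat_inv A"
proof -
  show inv: "invertible_mat A"
    using assms by (auto simp: invertible_mat_def inverts_mat_def)
  note C = mat_inv[OF A inv]
  have "B = B * (A * mat_inv A)" using B C(2) by simp
  also have "\<dots> = (B * A) * mat_inv A" using A B C(1) by simp
  also have "\<dots> = mat_inv A" using BA C(1) by simp
  finally show "B = mat_inv A" .
qed

theorem theorem7:
  fixes b k1 k2 :: nat and M :: "real mat" and T :: "real mat \<Rightarrow> bool"
  assumes "b \<ge> 1"
    and "T = upper_triangular \<or> T = lower_triangular"
    and "M \<in> carrier_mat b b" and "T M"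
    and "0 < k1 + k2" and "k1 + k2 < b"
  shows "T (trunc_mat k1 k2 M) \<and>
    (\<forall>N \<in> carrier_mat b b. T N \<longrightarrow>
       trunc_mat k1 k2 (M * N) = trunc_mat k1 k2 M * trunc_mat k1 k2 N) \<and>
    (invertible_mat M \<longrightarrow>
       invertible_mat (trunc_mat k1 k2 M) \<and>
       trunc_mat k1 k2 (mat_inv M) = mat_inv (trunc_mat k1 k2 M))"
proof (intro conjI ballI impI)
  note T = assms(2) and M = assms(3) and TM = assms(4)
  let ?tr = "trunc_mat k1 k2"
  have mult: "?tr (A * B) = ?tr A * ?tr B"
    if "A \<in> carrier_mat b b" "B \<in> carrier_mat b b" "T A" "T B" for A B
    using trunc_mat_mult_triangular[OF that(1,2)] T that(3,4) by auto
  show "T (?tr M)"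
    using T TM upper_triangular_trunc_mat[OF M] lower_triangular_trunc_mat[OF M] by auto
  show "?tr (M * N) = ?tr M * ?tr N" if "N \<in> carrier_mat b b" "T N" for N
    using mult[OF M that(1) TM that(2)] .
  assume "invertible_mat M"
  note inv = mat_inv[OF M this]
  have T_inv: "T (mat_inv M)"
    using T TM left_inverse_upper_triangular[OF M inv(1,3)]
      right_inverse_lower_triangular[OF M inv(1,2)] by auto
  have "?tr M * ?tr (mat_inv M) = 1\<^sub>m (b - k1 - k2)"
    using mult[OF M inv(1) TM T_inv] by (simp add: inv(2) trunc_mat_one)
  moreover have "?tr (mat_inv M) * ?tr M = 1\<^sub>m (b - k1 - k2)"
    using mult[OF inv(1) M T_inv TM] by (simp add: inv(3) trunc_mat_one)
  ultimately show "invertible_mat (?tr M)" "?tr (mat_inv M) = mat_inv (?tr M)"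
    using inverse_imp_mat_inv[OF trunc_mat_carrier[OF M] trunc_mat_carrier[OF inv(1)]] by auto
qed

end
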